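(* There exists a set $A\subseteq\mathbb{N}$ which is both additively thick and multiplicatively thick and contains no exponential triple, i.e. there are no $x,y\in A$ with $x\neq y$ and $x^y\in A$.
   Context: $A\subseteq\mathbb{N}$ is additively thick if for every finite $H\subseteq\mathbb{N}$ there is $x\in\mathbb{N}$ with $H+x=\{h+x:h\in H\}\subseteq A$, and multiplicatively thick if for every finite $H\subseteq\mathbb{N}$ there is $x\in\mathbb{N}$ with $Hx=\{hx:h\in H\}\subseteq A$. An exponential triple is a set $\{x,y,x^y\}$ with $x,y\in\mathbb{N}$, $x\neq y$. *)

theory Defs
  imports Main
begin

(* The natural numbers of the text are the positive integers, encoded as the set {0<..}
   of type nat.  With 0 admitted, multiplicative thickness would hold for every set
   containing 0 (multiply by x = 0), and H = {0} would force 0 into every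
   multiplicatively thick set, where 0 ^ y = 0. *)

definition additively_thick :: "nat set \<Rightarrow> bool" where
  "additively_thick A \<longleftrightarrow>
     (\<forall>H. finite H \<and> H \<subseteq> {0<..} \<longrightarrow> (\<exists>x\<in>{0<..}. (\<lambda>h. h + x) ` H \<subseteq> A))"

definition multiplicatively_thick :: "nat set \<Rightarrow> bool" where
  "multiplicatively_thick A \<longleftrightarrow>
     (\<forall>H. finite H \<and> H \<subseteq> {0<..} \<longrightarrow> (\<exists>x\<in>{0<..}. (\<lambda>h. h * x) ` H \<subseteq> A))"

definition exponential_triple :: "nat set \<Rightarrow> bool" where
  "exponential_triple T \<longleftrightarrow> (\<exists>x\<in>{0<..}. \<exists>y\<in>{0<..}. x \<noteq> y \<and> T = {x, y, x ^ y})"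

end

theory Submission
  imports Defs
begin

text \<open>
  An interval \<open>{c..n * c}\<close> contains the translate \<open>{1..n} + c\<close> as well as the dilate \<open>{1..n} * c\<close>,
  so a union of such intervals with \<open>n\<close> unbounded is thick in both senses.  If \<open>n < c\<close>, a power \<open>x ^ y\<close>
  whose base or exponent lies in or beyond an interval overshoots it; and if the left endpoints
  grow fast enough, powers of elements of earlier intervals fall short of it.
\<close>

text \<open>The first summand of the recursion bounds every power with base and exponent at most
  \<open>n * left_end n\<close>. The summand \<open>left_end n\<close> makes monotonicity immediate,
  and \<open>n + 3\<close> yields \<open>n + 2 \<le> left_end n\<close>.\<close>

fun left_end :: "nat \<Rightarrow> nat" where
  "left_end 0 = 2"
| "left_end (Suc n) = (n * left_end n) ^ (n * left_end n) + left_end n + n + 3"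

definition block :: "nat \<Rightarrow> nat set" where
  "block n = {left_end n..n * left_end n}"

lemma left_end_ge: "n + 2 \<le> left_end n"
  by (induction n) auto

lemma left_end_mono: "m \<le> n \<Longrightarrow> left_end m \<le> left_end n"
  by (rule lift_Suc_mono_le[of left_end]) auto

lemma block_ge: "x \<in> block n \<Longrightarrow> m \<le> n \<Longrightarrow> left_end m \<le> x"
  using left_end_mono[of m n] by (simp add: block_def)

lemma block_le: "x \<in> block m \<Longrightarrow> m \<le> n \<Longrightarrow> x \<le> n * left_end n"
  using left_end_mono[of m n] mult_le_mono[of m n "left_end m" "left_end n"]
  by (simp add: block_def)

lemma block_ge_2: "x \<in> block n \<Longrightarrow> 2 \<le> x"
  using block_ge[of x n 0] by simp

lemma Suc_square_less_two_power: "Suc k * Suc k < 2 ^ (k + 2)"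
proof (induction k)
  case (Suc k)
  \<comment> \<open>Twice \<open>Suc k * Suc k + 1\<close> exceeds the next square only for positive
    \<open>k\<close>, so \<open>k = 0\<close> is checked by itself.\<close>
  then show ?case by (cases k) (auto simp: algebra_simps)
qed simp

lemma block_end_less_two_power: "n * left_end n < 2 ^ left_end n"
proof -
  obtain k where k: "left_end n = k + 2" "n \<le> k"
    using left_end_ge[of n] that[of "left_end n - 2"] by simp
  have "n * left_end n \<le> k * (k + 2)"
    unfolding k(1) using k(2) by (rule mult_le_mono1)
  also have "\<dots> < Suc k * Suc k"
    by simp
  also have "\<dots> < 2 ^ left_end n"
    unfolding k(1) by (rule Suc_square_less_two_power)
  finally show ?thesis .
qed

lemma block_end_less_square: "n * left_end n < left_end n ^ 2"
  using left_end_ge[of n] by (simp add: power2_eq_square)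

text \<open>Base, exponent and power may lie in different blocks of the union, hence three
  independent indices.\<close>

lemma power_notin_block:
  assumes x: "x \<in> block i" and y: "y \<in> block j"
  shows "x ^ y \<notin> block k"
proof -
  have x2: "2 \<le> x" and y2: "2 \<le> y"
    using x y block_ge_2 by blast+
  consider "k \<le> i" | "k \<le> j" | "i < k" "j < k"
    by linarith
  then show ?thesis
  proof cases
    case 1
    then have "left_end k ^ 2 \<le> x ^ 2"
      using block_ge[OF x] by (simp add: power_mono)
    also have "\<dots> \<le> x ^ y"
      using x2 y2 by (intro power_increasing) auto
    finally show ?thesis
      using block_end_less_square[of k] by (simp add: block_def)
  next
    case 2
    then have "2 ^ left_end k \<le> (2::nat) ^ y"
      using block_ge[OF y] by (intro power_increasing) auto
    also have "\<dots> \<le> x ^ y"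
      using x2 by (simp add: power_mono)
    finally show ?thesis
      using block_end_less_two_power[of k] by (simp add: block_def)
  next
    case 3
    then obtain p where p: "k = Suc p" "i \<le> p" "j \<le> p"
      by (cases k) auto
    \<comment> \<open>The right endpoint of \<open>block p\<close> bounds both \<open>x\<close> and
      \<open>y\<close>, and \<open>M ^ M\<close> is the first summand of
      \<open>left_end (Suc p)\<close>.\<close>
    define M where "M = p * left_end p"
    have "x \<le> M" "y \<le> M"
      using block_le x y p unfolding M_def by blast+
    then have "x ^ y \<le> M ^ y" "M ^ y \<le> M ^ M"
      using x2 by (auto intro: power_mono power_increasing)
    then have "x ^ y < left_end k"
      using p(1) by (simp add: M_def)
    then show ?thesis
      by (simp add: block_def)
  qed
qed

text \<open>The left endpoint of a single block serves as both the shift and the multiplier.\<close>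

lemma block_absorbs:
  assumes "finite H" and "H \<subseteq> {0<..}"
  obtains n where "(\<lambda>h. h + left_end n) ` H \<subseteq> block n" "(\<lambda>h. h * left_end n) ` H \<subseteq> block n"
proof -
  obtain m where m: "\<And>h. h \<in> H \<Longrightarrow> h \<le> m"
    using assms(1) by (meson finite_nat_set_iff_bounded_le)
  \<comment> \<open>The offset ensures \<open>2 \<le> n\<close>: as
    \<open>h \<le> n \<le> left_end n\<close>, the shifted element is at most
    \<open>2 * left_end n\<close>, which must not pass the right endpoint.\<close>
  define n where "n = m + 2"
  have "h + left_end n \<in> block n \<and> h * left_end n \<in> block n" if "h \<in> H" for h
  proof -
    have h: "0 < h" "h \<le> n" "2 \<le> n"
      using m[OF that] assms(2) that by (auto simp: n_def)
    have "h + left_end n \<le> 2 * left_end n"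
      using h left_end_ge[of n] by simp
    also have "\<dots> \<le> n * left_end n"
      using h(3) by (rule mult_le_mono1)
    finally show ?thesis
      using h by (simp add: block_def)
  qed
  then show thesis
    by (intro that[of n]) auto
qed

theorem theorem5p1:
  "\<exists>A :: nat set. A \<subseteq> {0<..} \<and> additively_thick A \<and> multiplicatively_thick A \<and>
     \<not> (\<exists>T. exponential_triple T \<and> T \<subseteq> A)"
proof (intro exI conjI)
  let ?A = "\<Union>n. block n"
  have pos: "left_end n \<in> {0<..}" for n
    using left_end_ge[of n] by simp
  show "?A \<subseteq> {0<..}"
    using block_ge_2 by fastforce
  show "additively_thick ?A"
    unfolding additively_thick_def
  proof (intro allI impI, elim conjE)
    fix H :: "nat set"
    assume "finite H" "H \<subseteq> {0<..}"
    then obtain n where "(\<lambda>h. h + left_end n) ` H \<subseteq> block n"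
      by (rule block_absorbs)
    then show "\<exists>x\<in>{0<..}. (\<lambda>h. h + x) ` H \<subseteq> ?A"
      using pos by (intro bexI[of _ "left_end n"]) blast+
  qed
  show "multiplicatively_thick ?A"
    unfolding multiplicatively_thick_def
  proof (intro allI impI, elim conjE)
    fix H :: "nat set"
    assume "finite H" "H \<subseteq> {0<..}"
    then obtain n where "(\<lambda>h. h * left_end n) ` H \<subseteq> block n"
      by (rule block_absorbs)
    then show "\<exists>x\<in>{0<..}. (\<lambda>h. h * x) ` H \<subseteq> ?A"
      using pos by (intro bexI[of _ "left_end n"]) blast+
  qed
  show "\<not> (\<exists>T. exponential_triple T \<and> T \<subseteq> ?A)"
    using power_notin_block by (auto simp: exponential_triple_def)
qed

end
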